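(* The condition $R_{q,w}<\infty$, $w\ge1$, where $$R_{q,w}=\sum_{s=w}^\infty\binom{s}{w}^2\frac{(1-q)^{2(s-w)}}{q^{2s}}f_{W_q}(s),$$ is necessary for $T^{(2)}(\xi^{(1)})_{j,w}$ to have a limit in distribution as $j\to\infty$. That is, for each $w\ge1$: if $T^{(2)}(\xi^{(1)})_{j,w}$ converges in distribution as $j\to\infty$, then $R_{q,w}<\infty$.
   Context: $\mathbb N=\{1,2,\dots\}$, $q\in(0,1)$ is fixed. $W$ is a random variable with values in $\mathbb N$; given $W=w$, $W_q$ is Binomial$(w,q)$, and $f_{W_q}(s)=P(W_q=s)$. Let $z_1$ be a real number with $0<z_1<1-q$, $|z_1-(1-q)|<q$ and $z_1<1-z_1$ (that is, $z_0=1-q>z_1>z_2=0$ with $|z_k-z_{k-1}|<1-z_{k-1}$ for $k=1,2$). Let $\{\eta_s\}_{s\in\mathbb N}$ be i.i.d. standard normal variables and $\xi^{(1)}_s=f_{W_q}(s)^{1/2}\eta_s$, $s\in\mathbb N$. Define $$T^{(1)}(\xi^{(1)})_n=\sum_{s=n}^\infty\binom{s}{n}\frac{(z_1-(1-q))^{s-n}}{q^s}f_{W_q}(s)^{1/2}\eta_s,\qquad n\ge1$$ (an almost surely convergent series), and for $j\ge w\ge1$ $$T^{(2)}(\xi^{(1)})_{j,w}=\sum_{k=w}^j\binom{k}{w}(-z_1)^{k-w}\,T^{(1)}(\xi^{(1)})_k.$$ *)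

theory Defs
  imports "HOL-Probability.Probability"
begin

text \<open>
  The law of \<open>W\<close> is a probability mass function on \<^typ>\<open>nat\<close>.  Given \<open>W = w\<close>, the variable
  \<open>W\<^sub>q\<close> is binomial with parameters \<open>w\<close> and \<open>q\<close>, so its law is the corresponding mixture.
\<close>

definition Wq_pmf :: "nat pmf \<Rightarrow> real \<Rightarrow> nat pmf" where
  "Wq_pmf W q = bind_pmf W (\<lambda>w. binomial_pmf w q)"

definition f_Wq :: "nat pmf \<Rightarrow> real \<Rightarrow> nat \<Rightarrow> real" where
  "f_Wq W q s = pmf (Wq_pmf W q) s"

definition xi1 :: "nat pmf \<Rightarrow> real \<Rightarrow> (nat \<Rightarrow> 'a \<Rightarrow> real) \<Rightarrow> 'a \<Rightarrow> nat \<Rightarrow> real" where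
  "xi1 W q \<eta> \<omega> s = sqrt (f_Wq W q s) * \<eta> s \<omega>"

text \<open>
  The series runs over \<open>s = n + i\<close>, \<open>i \<ge> 0\<close>, and is the limit of its partial sums taken in this
  order.  Where it diverges, \<^const>\<open>suminf\<close> has a fixed but unspecified value; for
  \<open>x = xi1 W q \<eta> \<omega>\<close> and \<open>\<bar>z1 - (1 - q)\<bar> < q\<close> this happens only on a null set of \<open>\<omega>\<close>.
\<close>

definition T1 :: "real \<Rightarrow> real \<Rightarrow> (nat \<Rightarrow> real) \<Rightarrow> nat \<Rightarrow> real" where
  "T1 q z1 x n =
     (\<Sum>i. let s = n + i in
        real (s choose n) * (z1 - (1 - q)) ^ (s - n) / q ^ s * x s)"

definition T2 :: "real \<Rightarrow> real \<Rightarrow> (nat \<Rightarrow> real) \<Rightarrow> nat \<Rightarrow> nat \<Rightarrow> real" where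
  "T2 q z1 x j w = (\<Sum>k=w..j. real (k choose w) * (- z1) ^ (k - w) * T1 q z1 x k)"

text \<open>
  All summands are nonnegative; the sum is extended-real valued, so that finiteness is a condition.
\<close>

definition R :: "nat pmf \<Rightarrow> real \<Rightarrow> nat \<Rightarrow> ennreal" where
  "R W q w =
     (\<Sum>i. let s = w + i in
        ennreal ((real (s choose w))\<^sup>2 * (1 - q) ^ (2 * (s - w)) / q ^ (2 * s) * f_Wq W q s))"

text \<open>The limit law is required to be a probability measure: no mass may escape to infinity.\<close>

definition converges_in_distribution :: "'a measure \<Rightarrow> (nat \<Rightarrow> 'a \<Rightarrow> real) \<Rightarrow> bool" where
  "converges_in_distribution M X \<longleftrightarrow>
     (\<exists>\<mu>. real_distribution \<mu> \<and> weak_conv_m (\<lambda>j. distr M borel (X j)) \<mu>)"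

end

theory Submission
  imports Defs
begin

text \<open>
  Fix \<open>j\<close>.  Interchanging the finite sum over \<open>k\<close> with the part \<open>s \<le> j\<close> of the series and applying
  the binomial theorem, the coefficient of \<open>\<eta> s\<close> in \<open>T2\<close> is, for \<open>w \<le> s \<le> j\<close>, equal to
  \<open>(s choose w) (q - 1)^(s - w) / q^s\<close> times \<open>sqrt (f_Wq W q s)\<close>, so that the variances \<open>V j\<close> of
  these terms add up to the partial sums of \<open>R\<close>.  What remains of \<open>T2\<close> involves only the \<open>\<eta> s\<close>
  with \<open>s > j\<close> and is therefore independent of the Gaussian main part.  Hence the characteristic
  function of \<open>T2\<close> at \<open>t\<close> is bounded by \<open>exp (- t\<^sup>2 V j / 2)\<close>.  A limit law has a characteristic
  function that does not vanish near \<open>0\<close>, so \<open>V j\<close> stays bounded.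
\<close>

section \<open>Rearranging \<open>T2\<close> at the cutoff \<open>j\<close>\<close>

definition T1_coeff :: "real \<Rightarrow> real \<Rightarrow> nat \<Rightarrow> nat \<Rightarrow> real" where
  "T1_coeff q z1 n s = real (s choose n) * (z1 - (1 - q)) ^ (s - n) / q ^ s"

definition T2_head :: "real \<Rightarrow> (nat \<Rightarrow> real) \<Rightarrow> nat \<Rightarrow> nat \<Rightarrow> real" where
  "T2_head q x j w = (\<Sum>s=w..j. real (s choose w) * (q - 1) ^ (s - w) / q ^ s * x s)"

text \<open>The series stay inside the finite sum over \<open>k\<close>, so only finite sums ever
  have to be interchanged.\<close>

definition T2_tail :: "real \<Rightarrow> real \<Rightarrow> (nat \<Rightarrow> real) \<Rightarrow> nat \<Rightarrow> nat \<Rightarrow> real" where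
  "T2_tail q z1 x j w =
     (\<Sum>k=w..j. real (k choose w) * (- z1) ^ (k - w) *
        (\<Sum>i. T1_coeff q z1 k (Suc j + i) * x (Suc j + i)))"

text \<open>This is the binomial series of \<open>(1 - r)\<close> to the power
  \<open>-(n + 1)\<close>, which converges for \<open>\<bar>r\<bar> < 1\<close>.\<close>

lemma summable_binomial_geometric:
  fixes r :: real
  assumes "\<bar>r\<bar> < 1"
  shows "summable (\<lambda>i. real (n + i choose n) * r ^ i)"
proof -
  have "(- (real n + 1) gchoose i) * (- r) ^ i = real (n + i choose n) * r ^ i" for i
  proof -
    \<comment> \<open>The upper argument is written in the shape that the reflection formula
      \<open>gbinomial_minus\<close> produces for \<open>real n + 1\<close>.\<close>
    have "real (n + i choose n) = (real n + 1 + real i - 1) gchoose i"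
      by (metis add_diff_cancel_left' binomial_gbinomial binomial_symmetric le_add1 of_nat_add
          add.commute add_diff_cancel_right' group_cancel.add1)
    then show ?thesis
      unfolding gbinomial_minus power_minus[of r] by (simp add: mult_ac)
  qed
  with gen_binomial_real[of "- r" "- (real n + 1)"] assms show ?thesis
    by (auto simp: sums_iff)
qed

text \<open>Up to the factor \<open>1 / q ^ n\<close>, this is the preceding series with ratio
  \<open>\<bar>z1 - (1 - q)\<bar> / q\<close>.\<close>

lemma summable_T1_coeff:
  assumes "0 < q" "\<bar>z1 - (1 - q)\<bar> < q"
  shows "summable (\<lambda>i. \<bar>T1_coeff q z1 n (n + i)\<bar>)"
proof -
  have "\<bar>\<bar>z1 - (1 - q)\<bar> / q\<bar> < 1"
    using assms by simp
  from summable_mult2[OF summable_binomial_geometric[OF this, of n], of "1 / q ^ n"] show ?thesis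
    using assms by (simp add: T1_coeff_def abs_mult power_abs power_divide power_add mult_ac)
qed

text \<open>Summability permits splitting off an initial segment; for a divergent series
  \<open>suminf\<close> is an unspecified value.\<close>

lemma T1_split:
  assumes "summable (\<lambda>i. T1_coeff q z1 n (n + i) * x (n + i))" "n \<le> j"
  shows "T1 q z1 x n = (\<Sum>s=n..j. T1_coeff q z1 n s * x s) +
           (\<Sum>i. T1_coeff q z1 n (Suc j + i) * x (Suc j + i))"
proof -
  let ?g = "\<lambda>s. T1_coeff q z1 n s * x s"
  have "T1 q z1 x n = (\<Sum>i. ?g (n + i))"
    by (simp add: T1_def T1_coeff_def Let_def)
  also have "\<dots> = (\<Sum>i. ?g (n + (i + (Suc j - n)))) + (\<Sum>i<Suc j - n. ?g (n + i))"
    using assms(1) by (rule suminf_split_initial_segment)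
  also have "(\<lambda>i. ?g (n + (i + (Suc j - n)))) = (\<lambda>i. ?g (Suc j + i))"
    using assms(2) by (simp add: add_ac)
  also have "(\<Sum>i<Suc j - n. ?g (n + i)) = (\<Sum>s=n..j. ?g s)"
    using assms(2)
    by (intro sum.reindex_bij_witness[of _ "\<lambda>s. s - n" "\<lambda>i. n + i"]) auto
  finally show ?thesis
    by simp
qed

text \<open>Trinomial revision pulls out \<open>s choose w\<close>. The binomial theorem then sums
  the rest to a power of \<open>- z1 + (z1 - (1 - q))\<close>, in which \<open>z1\<close>
  cancels.\<close>

lemma sum_T1_coeff:
  assumes "w \<le> s"
  shows "(\<Sum>k=w..s. real (k choose w) * (- z1) ^ (k - w) * T1_coeff q z1 k s) =
           real (s choose w) * (q - 1) ^ (s - w) / q ^ s"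
proof -
  let ?a = "z1 - (1 - q)"
  have "(\<Sum>k=w..s. real (k choose w) * (- z1) ^ (k - w) * T1_coeff q z1 k s) =
      (\<Sum>k=w..s. real (s choose w) / q ^ s *
         (real (s - w choose (k - w)) * (- z1) ^ (k - w) * ?a ^ (s - w - (k - w))))"
  proof (rule sum.cong[OF refl])
    fix k assume k: "k \<in> {w..s}"
    then have "real (s choose k) * real (k choose w) = real (s choose w) * real (s - w choose (k - w))"
      by (metis atLeastAtMost_iff choose_mult of_nat_mult)
    with k show "real (k choose w) * (- z1) ^ (k - w) * T1_coeff q z1 k s =
        real (s choose w) / q ^ s *
         (real (s - w choose (k - w)) * (- z1) ^ (k - w) * ?a ^ (s - w - (k - w)))"
      by (simp add: T1_coeff_def field_simps)
  qed
  also have "\<dots> = real (s choose w) / q ^ s *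
      (\<Sum>i\<le>s - w. real (s - w choose i) * (- z1) ^ i * ?a ^ (s - w - i))"
    unfolding sum_distrib_left[symmetric] using assms
    by (intro arg_cong2[where f = "(*)"] refl
        sum.reindex_bij_witness[of _ "\<lambda>i. i + w" "\<lambda>k. k - w"]) auto
  also have "\<dots> = real (s choose w) / q ^ s * (- z1 + ?a) ^ (s - w)"
    by (simp only: binomial_ring)
  finally show ?thesis
    by simp
qed

lemma T2_split:
  assumes "\<And>k. k \<in> {w..j} \<Longrightarrow> summable (\<lambda>i. T1_coeff q z1 k (k + i) * x (k + i))"
  shows "T2 q z1 x j w = T2_head q x j w + T2_tail q z1 x j w"
proof -
  let ?b = "\<lambda>k. real (k choose w) * (- z1) ^ (k - w)"
  have "T2 q z1 x j w =
      (\<Sum>k=w..j. ?b k * (\<Sum>s=k..j. T1_coeff q z1 k s * x s)) + T2_tail q z1 x j w"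
    unfolding T2_def T2_tail_def sum.distrib[symmetric] distrib_left[symmetric]
    by (intro sum.cong refl arg_cong2[where f = "(*)"] T1_split assms) auto
  \<comment> \<open>Both orders of summation run over the triangle
    \<open>w \<le> k \<le> s \<le> j\<close>.\<close>
  also have "(\<Sum>k=w..j. ?b k * (\<Sum>s=k..j. T1_coeff q z1 k s * x s)) =
      (\<Sum>k\<in>{w..j}. \<Sum>s | s \<in> {w..j} \<and> k \<le> s. ?b k * (T1_coeff q z1 k s * x s))"
    unfolding sum_distrib_left by (intro sum.cong) auto
  also have "\<dots> = (\<Sum>s\<in>{w..j}. \<Sum>k | k \<in> {w..j} \<and> k \<le> s. ?b k * (T1_coeff q z1 k s * x s))"
    by (rule sum.swap_restrict) auto
  also have "\<dots> = (\<Sum>s=w..j. (\<Sum>k=w..s. ?b k * T1_coeff q z1 k s) * x s)"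
    unfolding sum_distrib_right by (intro sum.cong) (auto simp: mult_ac)
  also have "\<dots> = T2_head q x j w"
    unfolding T2_head_def by (intro sum.cong refl) (simp add: sum_T1_coeff)
  finally show ?thesis .
qed

section \<open>Series and sums of standard normal variables\<close>

lemma (in prob_space) distr_std_normal:
  assumes "distributed M lborel X std_normal_density"
  shows "distr M borel X = std_normal_distribution"
  using distributed_distr_eq_density[OF assms] by (simp cong: distr_cong)

text \<open>All \<open>X i\<close> share the finite first absolute moment \<open>E\<close>, so the
  sum of the \<open>\<bar>c i * X i\<bar>\<close> has finite expectation and is therefore finite
  almost surely.\<close>

lemma (in prob_space) AE_summable_std_normal:
  fixes X :: "nat \<Rightarrow> 'a \<Rightarrow> real"
  assumes X: "\<And>i. distributed M lborel (X i) std_normal_density"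
    and c: "summable (\<lambda>i. \<bar>c i\<bar>)"
  shows "AE \<omega> in M. summable (\<lambda>i. c i * X i \<omega>)"
proof -
  have [measurable]: "X i \<in> borel_measurable M" for i
    using distributed_measurable[OF X] by simp
  define E where "E = (\<integral>x. \<bar>x\<bar> \<partial>std_normal_distribution)"
  have int: "integrable std_normal_distribution (\<lambda>x. \<bar>x\<bar>)"
    using integrable_std_normal_distribution_moment[of 1] by (simp add: integrable_abs)
  have E: "0 \<le> E"
    by (simp add: E_def)
  have nn: "(\<integral>\<^sup>+\<omega>. ennreal \<bar>c i * X i \<omega>\<bar> \<partial>M) = ennreal (\<bar>c i\<bar> * E)" for i
  proof -
    have "(\<integral>\<^sup>+\<omega>. ennreal \<bar>X i \<omega>\<bar> \<partial>M) = (\<integral>\<^sup>+x. ennreal \<bar>x\<bar> \<partial>distr M borel (X i))"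
      by (subst nn_integral_distr) auto
    also have "\<dots> = ennreal E"
      unfolding E_def distr_std_normal[OF X] using int by (intro nn_integral_eq_integral) auto
    finally show ?thesis
      using E by (simp add: abs_mult ennreal_mult nn_integral_cmult)
  qed
  have "(\<integral>\<^sup>+\<omega>. (\<Sum>i. ennreal \<bar>c i * X i \<omega>\<bar>) \<partial>M) = (\<Sum>i. ennreal (\<bar>c i\<bar> * E))"
    by (subst nn_integral_suminf) (auto simp: nn)
  also have "\<dots> \<noteq> \<infinity>"
    using E c by (simp add: ennreal_suminf_neq_top summable_mult2)
  finally have "AE \<omega> in M. (\<Sum>i. ennreal \<bar>c i * X i \<omega>\<bar>) \<noteq> \<infinity>"
    by (intro nn_integral_PInf_AE) auto
  then show ?thesis
  proof eventually_elim
    case (elim \<omega>)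
    then have "summable (\<lambda>i. \<bar>c i * X i \<omega>\<bar>)"
      by (intro summable_suminf_not_top) auto
    then show ?case
      by (rule summable_rabs_cancel)
  qed
qed

lemma (in prob_space) char_sum_std_normal:
  assumes ind: "indep_vars (\<lambda>_. borel) X A"
    and X: "\<And>i. i \<in> A \<Longrightarrow> distributed M lborel (X i) std_normal_density"
  shows "char (distr M borel (\<lambda>\<omega>. \<Sum>i\<in>A. c i * X i \<omega>)) t =
           of_real (exp (- (t\<^sup>2 * (\<Sum>i\<in>A. (c i)\<^sup>2)) / 2))"
proof (cases "finite A")
  case True
  have "indep_vars (\<lambda>_. borel) (\<lambda>i \<omega>. c i * X i \<omega>) A"
    using indep_vars_compose2[OF ind, of "\<lambda>i x. c i * x" "\<lambda>_. borel"] by simp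
  then have "char (distr M borel (\<lambda>\<omega>. \<Sum>i\<in>A. c i * X i \<omega>)) t =
      (\<Prod>i\<in>A. char (distr M borel (\<lambda>\<omega>. c i * X i \<omega>)) t)"
    by (rule char_distr_sum)
  also have "\<dots> = (\<Prod>i\<in>A. of_real (exp (- (t\<^sup>2 * (c i)\<^sup>2) / 2)))"
  proof (rule prod.cong[OF refl])
    fix i assume i: "i \<in> A"
    then have [measurable]: "X i \<in> borel_measurable M"
      using distributed_measurable[OF X] by simp
    have "char (distr M borel (\<lambda>\<omega>. c i * X i \<omega>)) t = char (distr M borel (X i)) (t * c i)"
      by (simp add: char_def integral_distr mult_ac)
    also have "\<dots> = of_real (exp (- (t\<^sup>2 * (c i)\<^sup>2) / 2))"
      by (simp add: distr_std_normal[OF X[OF i]] char_std_normal_distribution power_mult_distrib)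
    finally show "char (distr M borel (\<lambda>\<omega>. c i * X i \<omega>)) t =
        of_real (exp (- (t\<^sup>2 * (c i)\<^sup>2) / 2))" .
  qed
  also have "\<dots> = of_real (exp (\<Sum>i\<in>A. - (t\<^sup>2 * (c i)\<^sup>2) / 2))"
    using True by (simp only: exp_sum of_real_prod)
  also have "(\<Sum>i\<in>A. - (t\<^sup>2 * (c i)\<^sup>2) / 2) = - (t\<^sup>2 * (\<Sum>i\<in>A. (c i)\<^sup>2)) / 2"
    by (simp add: sum_distrib_left sum_negf sum_divide_distrib)
  finally show ?thesis .
\<comment> \<open>For infinite \<open>A\<close> both sums are 0 by convention, and both sides equal
  1.\<close>
qed (simp add: char_def integral_distr prob_space del: distr_const)

text \<open>The characteristic function of the sum factors, and the factor of \<open>Y\<close> has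
  modulus at most 1.\<close>

lemma (in prob_space) norm_char_add_le:
  fixes X Y :: "'a \<Rightarrow> real"
  assumes "indep_var borel X borel Y"
  shows "norm (char (distr M borel (\<lambda>\<omega>. X \<omega> + Y \<omega>)) t) \<le> norm (char (distr M borel X) t)"
proof -
  from assms have "Y \<in> borel_measurable M"
    by (rule indep_var_rv2)
  then have "real_distribution (distr M borel Y)"
    by simp
  then show ?thesis
    by (simp add: char_distr_add[OF assms] norm_mult mult_left_le real_distribution.cmod_char_le_1)
qed

text \<open>With coordinate projections in place of \<open>\<eta>\<close>, head and tail become
  functions on a product space, applied to a block of the variables.\<close>

lemma xi1_restrict: "s \<in> A \<Longrightarrow> xi1 W q (\<lambda>s y. y s) (restrict (\<lambda>i. \<eta> i \<omega>) A) s = xi1 W q \<eta> \<omega> s"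
  by (simp add: xi1_def)

text \<open>The head uses only the block \<open>{w..j}\<close> and the tail only
  \<open>{Suc j..}\<close>; these are disjoint subsets of \<open>{1..}\<close>.\<close>

lemma (in prob_space) indep_T2_head_tail:
  assumes ind: "indep_vars (\<lambda>_. borel) \<eta> {1::nat..}" and "1 \<le> w"
  shows "indep_var borel (\<lambda>\<omega>. T2_head q (xi1 W q \<eta> \<omega>) j w)
           borel (\<lambda>\<omega>. T2_tail q z1 (xi1 W q \<eta> \<omega>) j w)"
proof -
  let ?P = "\<lambda>s y. y s :: real"
  have 1: "(\<lambda>y. T2_head q (xi1 W q ?P y) j w) \<in> borel_measurable (PiM {w..j} (\<lambda>_. borel))"
    unfolding T2_head_def xi1_def by measurable
  \<comment> \<open>\<open>suminf\<close> of measurable functions is measurable everywhere,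
    including the points of divergence.\<close>
  have 2: "(\<lambda>y. T2_tail q z1 (xi1 W q ?P y) j w) \<in> borel_measurable (PiM {Suc j..} (\<lambda>_. borel))"
    unfolding T2_tail_def xi1_def
    by (intro borel_measurable_sum borel_measurable_times borel_measurable_const
        borel_measurable_suminf measurable_component_singleton) auto
  have "indep_var (PiM {w..j} (\<lambda>_. borel)) (\<lambda>\<omega>. restrict (\<lambda>i. \<eta> i \<omega>) {w..j})
      (PiM {Suc j..} (\<lambda>_. borel)) (\<lambda>\<omega>. restrict (\<lambda>i. \<eta> i \<omega>) {Suc j..})"
    using assms by (intro indep_var_restrict) auto
  from indep_var_compose[OF this 1 2] show ?thesis
    by (simp add: comp_def T2_head_def T2_tail_def xi1_restrict)
qed

text \<open>The summands are those of \<open>R\<close>, since squaring removes the sign of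
  \<open>q - 1\<close>; a bound uniform in \<open>j\<close> makes the nonnegative series
  converge.\<close>

lemma R_finite_if_bounded:
  assumes "0 < q"
    and B: "\<And>j. (\<Sum>s=w..j. (real (s choose w) * (q - 1) ^ (s - w) / q ^ s)\<^sup>2 * f_Wq W q s) \<le> B"
  shows "R W q w < \<infinity>"
proof -
  let ?c = "\<lambda>s. (real (s choose w) * (q - 1) ^ (s - w) / q ^ s)\<^sup>2 * f_Wq W q s"
  have nonneg: "0 \<le> ?c s" for s
    by (simp add: f_Wq_def)
  have "summable (\<lambda>i. ?c (w + i))"
  proof (rule bounded_imp_summable)
    fix n
    have "(\<Sum>i\<le>n. ?c (w + i)) = (\<Sum>s=w..w + n. ?c s)"
      by (intro sum.reindex_bij_witness[of _ "\<lambda>s. s - w" "\<lambda>i. w + i"]) auto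
    also have "\<dots> \<le> B"
      by (rule B)
    finally show "(\<Sum>i\<le>n. ?c (w + i)) \<le> B" .
  qed (rule nonneg)
  then have "(\<Sum>i. ennreal (?c (w + i))) < \<infinity>"
    using nonneg unfolding infinity_ennreal_def less_top[symmetric] by (rule ennreal_suminf_neq_top)
  moreover have "R W q w = (\<Sum>i. ennreal (?c (w + i)))"
  proof -
    have "((q - 1) ^ i)\<^sup>2 = (1 - q) ^ (2 * i)" for i
      unfolding power_mult power2_commute[of 1 q] by (simp only: mult.commute flip: power_mult)
    then show ?thesis
      by (simp add: R_def Let_def power_mult_distrib power_divide power_even_eq)
  qed
  ultimately show ?thesis
    by simp
qed

theorem proposition4p4:
  fixes W :: "nat pmf" and q z1 :: real
    and M :: "'a measure" and \<eta> :: "nat \<Rightarrow> 'a \<Rightarrow> real" and w :: nat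
  assumes "0 < q" and "q < 1"
    and "0 \<notin> set_pmf W"
    and "0 < z1" and "z1 < 1 - q" and "\<bar>z1 - (1 - q)\<bar> < q" and "z1 < 1 - z1"
    and "prob_space M"
    and "prob_space.indep_vars M (\<lambda>_. borel) \<eta> {1..}"
    and "\<And>s. s \<ge> 1 \<Longrightarrow> distributed M lborel (\<eta> s) std_normal_density"
    and "w \<ge> 1"
    and "converges_in_distribution M (\<lambda>j \<omega>. T2 q z1 (xi1 W q \<eta> \<omega>) j w)"
  shows "R W q w < \<infinity>"
proof -
  interpret prob_space M by fact
  note ind = assms(9) and normal = assms(10)
  define x where "x = xi1 W q \<eta>"
  define V where
    "V j = (\<Sum>s=w..j. (real (s choose w) * (q - 1) ^ (s - w) / q ^ s)\<^sup>2 * f_Wq W q s)" for j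
  have f: "0 \<le> f_Wq W q s" "f_Wq W q s \<le> 1" for s
    by (simp_all add: f_Wq_def pmf_le_1)
  have rv: "\<eta> s \<in> borel_measurable M" if "1 \<le> s" for s
    using distributed_measurable[OF normal[OF that]] by simp
  have T2_rv: "(\<lambda>\<omega>. T2 q z1 (x \<omega>) j w) \<in> borel_measurable M" for j
    unfolding T2_def T1_def x_def xi1_def Let_def using \<open>w \<ge> 1\<close>
    by (intro borel_measurable_sum borel_measurable_times borel_measurable_const
        borel_measurable_suminf rv) auto
  note indep = indep_T2_head_tail[OF ind \<open>w \<ge> 1\<close>, of q W _ z1, folded x_def]
  have [measurable]: "(\<lambda>\<omega>. T2_head q (x \<omega>) j w + T2_tail q z1 (x \<omega>) j w) \<in> borel_measurable M" for j
    using indep_var_rv1[OF indep] indep_var_rv2[OF indep] by simp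
  have summable: "AE \<omega> in M. summable (\<lambda>i. T1_coeff q z1 k (k + i) * x \<omega> (k + i))" if "1 \<le> k" for k
  proof -
    \<comment> \<open>The weights \<open>sqrt (f_Wq W q s)\<close> are at most 1, so the series of
      the bare coefficients dominates.\<close>
    have "summable (\<lambda>i. \<bar>T1_coeff q z1 k (k + i) * sqrt (f_Wq W q (k + i))\<bar>)"
      using summable_T1_coeff[OF \<open>0 < q\<close> \<open>\<bar>z1 - (1 - q)\<bar> < q\<close>, of k]
      by (rule summable_comparison_test'[where N = 0]) (simp add: abs_mult f mult_left_le)
    then have "AE \<omega> in M.
        summable (\<lambda>i. T1_coeff q z1 k (k + i) * sqrt (f_Wq W q (k + i)) * \<eta> (k + i) \<omega>)"
      using that by (intro AE_summable_std_normal normal) auto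
    then show ?thesis
      by (simp add: x_def xi1_def mult_ac)
  qed
  have split: "AE \<omega> in M. T2 q z1 (x \<omega>) j w = T2_head q (x \<omega>) j w + T2_tail q z1 (x \<omega>) j w" for j
  proof -
    \<comment> \<open>Only finitely many \<open>k\<close> occur for a given \<open>j\<close>, so the
      exceptional null sets can be united.\<close>
    have "AE \<omega> in M. \<forall>k\<in>{w..j}. summable (\<lambda>i. T1_coeff q z1 k (k + i) * x \<omega> (k + i))"
      using \<open>w \<ge> 1\<close> by (intro AE_finite_allI summable) auto
    then show ?thesis
      by eventually_elim (auto intro!: T2_split)
  qed
  have head: "char (distr M borel (\<lambda>\<omega>. T2_head q (x \<omega>) j w)) t = of_real (exp (- (t\<^sup>2 * V j) / 2))"
    for j t
  proof -
    have "indep_vars (\<lambda>_. borel) \<eta> {w..j}"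
      using ind by (rule indep_vars_subset) (use \<open>w \<ge> 1\<close> in auto)
    from char_sum_std_normal[OF this normal,
        of "\<lambda>s. real (s choose w) * (q - 1) ^ (s - w) / q ^ s * sqrt (f_Wq W q s)" t]
    have "char (distr M borel (\<lambda>\<omega>. T2_head q (x \<omega>) j w)) t = of_real (exp (- (t\<^sup>2 * (\<Sum>s=w..j.
        (real (s choose w) * (q - 1) ^ (s - w) / q ^ s * sqrt (f_Wq W q s))\<^sup>2)) / 2))"
      using \<open>w \<ge> 1\<close> by (simp only: T2_head_def x_def xi1_def mult.assoc) simp
    then show ?thesis
      unfolding V_def by (simp only: power_mult_distrib[of _ "sqrt _"] real_sqrt_pow2[OF f(1)])
  qed
  have bound: "norm (char (distr M borel (\<lambda>\<omega>. T2 q z1 (x \<omega>) j w)) t) \<le> exp (- (t\<^sup>2 * V j) / 2)" for j t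
  proof -
    have "distr M borel (\<lambda>\<omega>. T2 q z1 (x \<omega>) j w) =
        distr M borel (\<lambda>\<omega>. T2_head q (x \<omega>) j w + T2_tail q z1 (x \<omega>) j w)"
      using split T2_rv by (intro distr_cong_AE) auto
    then show ?thesis
      using norm_char_add_le[OF indep, of j t] by (simp add: head)
  qed
  obtain \<mu> where \<mu>: "real_distribution \<mu>"
    and conv: "weak_conv_m (\<lambda>j. distr M borel (\<lambda>\<omega>. T2 q z1 (x \<omega>) j w)) \<mu>"
    using assms(12) unfolding converges_in_distribution_def x_def by blast
  interpret \<mu>: real_distribution \<mu> by fact
  \<comment> \<open>\<open>char \<mu>\<close> is continuous with value 1 at 0. Below,
    \<open>t \<noteq> 0\<close> is kept as well, to divide by \<open>t\<^sup>2\<close>.\<close>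
  have "\<forall>\<^sub>F t in at 0. char \<mu> t \<noteq> 0"
    using \<mu>.isCont_char[of 0]
    by (intro tendsto_imp_eventually_ne[of _ 1]) (simp_all add: isCont_def \<mu>.char_zero)
  then have "\<forall>\<^sub>F t in at 0. char \<mu> t \<noteq> 0 \<and> t \<noteq> 0"
    by (intro eventually_conj eventually_neq_at_within)
  then obtain t where t: "char \<mu> t \<noteq> 0" "t \<noteq> 0"
    by (auto dest: eventually_happens simp: trivial_limit_at)
  have lim: "(\<lambda>j. norm (char (distr M borel (\<lambda>\<omega>. T2 q z1 (x \<omega>) j w)) t)) \<longlonglongrightarrow> norm (char \<mu> t)"
    using T2_rv \<mu> conv by (intro tendsto_norm levy_continuity1) auto
  have V_mono: "V i \<le> V j" if "i \<le> j" for i j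
    unfolding V_def using that by (intro sum_mono2) (auto simp: f)
  have "V i \<le> - 2 * ln (norm (char \<mu> t)) / t\<^sup>2" for i
  proof -
    \<comment> \<open>With \<open>i\<close> fixed, let \<open>j\<close> tend to infinity: for
      \<open>j \<ge> i\<close> the bound with \<open>V j\<close> implies the one with
      \<open>V i\<close>. Taking logarithms then bounds \<open>V i\<close> independently of
      \<open>i\<close>.\<close>
    have "norm (char \<mu> t) \<le> exp (- (t\<^sup>2 * V i) / 2)"
    proof (rule tendsto_upperbound[OF lim])
      show "\<forall>\<^sub>F j in sequentially. norm (char (distr M borel (\<lambda>\<omega>. T2 q z1 (x \<omega>) j w)) t)
          \<le> exp (- (t\<^sup>2 * V i) / 2)"
        using eventually_ge_at_top[of i]
      proof eventually_elim
        case (elim j)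
        then have "exp (- (t\<^sup>2 * V j) / 2) \<le> exp (- (t\<^sup>2 * V i) / 2)"
          by (simp add: mult_left_mono V_mono)
        with bound[of j t] show ?case
          by linarith
      qed
    qed simp
    then have "ln (norm (char \<mu> t)) \<le> - (t\<^sup>2 * V i) / 2"
      using t by (metis ln_exp ln_mono exp_gt_zero zero_less_norm_iff)
    then show ?thesis
      using t by (simp add: field_simps)
  qed
  with R_finite_if_bounded[OF \<open>0 < q\<close>, of w W] show ?thesis
    unfolding V_def by blast
qed

end
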